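(* Let $t, r$ be integers with $1 \leq t \leq r$, and let $\mathcal{H}$ be a hereditary family with $\mu(\mathcal{H}) \geq n_{\rm S}(r,t)$. Let $k \geq 2$, and, for each $i \in [k]$, let $\emptyset \neq S_i \subseteq [t,r]$, $\mathcal{F}_i := \bigcup_{s \in S_i}\mathcal{H}^{(s)}$ and $\mathcal{T}_i := \{T \in \mathcal{H}^{(t)} : \mathcal{F}_i \langle T \rangle \text{ is a largest } t\text{-star of } \mathcal{F}_i\}$. Let $\mathcal{A}_1, \dots, \mathcal{A}_k$ be cross-$t$-intersecting families such that $\mathcal{A}_i \subseteq \mathcal{F}_i$ for all $i \in [k]$. Then $\mathcal{T}_i \neq \emptyset$ for all $i \in [k]$, and, for any $T_1 \in \mathcal{T}_1, \dots, T_k \in \mathcal{T}_k$, \[\sum_{i = 1}^k |\mathcal{A}_i| \leq \max\left\{\sum_{i = 1}^k |\mathcal{F}_i \langle T_i \rangle|, |\mathcal{F}_1|, \dots, |\mathcal{F}_k|\right\}.\] Moreover, equality holds if and only if one of the following holds: (i) $\sum_{i = 1}^k |\mathcal{F}_i \langle T_i \rangle| > \max\{|\mathcal{F}_1|, \dots, |\mathcal{F}_k|\}$, $\bigcap_{i = 1}^k \mathcal{T}_i \neq \emptyset$ and, for some $T \in \bigcap_{i = 1}^k \mathcal{T}_i$, $\mathcal{A}_i = \mathcal{F}_i\langle T \rangle$ for all $i \in [k]$; (ii) $\sum_{i = 1}^k |\mathcal{F}_i \langle T_i \rangle| < \max\{|\mathcal{F}_1|, \dots, |\mathcal{F}_k|\}$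 and, for some $j \in [k]$ such that $|\mathcal{F}_j| = \max\{|\mathcal{F}_i| : i \in [k]\}$, $\mathcal{A}_j = \mathcal{F}_j$ and $\mathcal{A}_i = \emptyset$ for all $i \in [k] \setminus \{j\}$; (iii) $\sum_{i = 1}^k |\mathcal{F}_i \langle T_i \rangle| = \max\{|\mathcal{F}_1|, \dots, |\mathcal{F}_k|\}$, and $\mathcal{A}_1, \dots, \mathcal{A}_k$ are as in (i) or (ii).
   Context: All sets and families are finite. For integers $m \le n$, $[m,n] := \{i \in \{1,2,\dots\} : m \le i \le n\}$ and $[n] := [1,n]$. A family $\mathcal{H}$ is hereditary if every subset of every member of $\mathcal{H}$ is a member of $\mathcal{H}$. A base of a family $\mathcal{F}$ is a set $B \in \mathcal{F}$ that is not a proper subset of any member of $\mathcal{F}$; $\mu(\mathcal{F})$ denotes the size of a smallest base of $\mathcal{F}$. $\mathcal{H}^{(s)} := \{H \in \mathcal{H} : |H| = s\}$. For a family $\mathcal{F}$ and a set $T$, $\mathcal{F}\langle T\rangle := \{F \in \mathcal{F} : T \subseteq F\}$; this is a $t$-star of $\mathcal{F}$ if $|T| = t$, and a largest $t$-star is one of maximum size among all $t$-stars of $\mathcal{F}$. A set $A$ $t$-intersects $B$ if $|A\cap B| \ge t$. Families $\mathcal{A}_1,\dots,\mathcal{A}_k$ are cross-$t$-intersecting if for all distinct $i,j \in [k]$, every set in $\mathcal{A}_i$ $t$-intersects every set in $\mathcal{A}_j$. Define $m(r,t) := \max\{2r, \frac{(r-t)(r-t+5)}{2} + (t-1)\}$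 and $n_{\rm S}(r,t) := (r-t+1)\binom{m(r,t)}{t+1} + r$. *)

theory Defs
  imports Complex_Main
begin

definition hereditary :: "'a set set \<Rightarrow> bool" where
  "hereditary H \<longleftrightarrow> (\<forall>A\<in>H. \<forall>B. B \<subseteq> A \<longrightarrow> B \<in> H)"

definition is_base :: "'a set set \<Rightarrow> 'a set \<Rightarrow> bool" where
  "is_base F B \<longleftrightarrow> B \<in> F \<and> (\<forall>A\<in>F. \<not> B \<subset> A)"

text \<open>The size of a smallest base. This is meaningful for a nonempty finite family, which always
  has a base; the value is unspecified for the empty family.\<close>

definition mu :: "'a set set \<Rightarrow> nat" where
  "mu F = Min (card ` {B. is_base F B})"

definition level :: "'a set set \<Rightarrow> nat \<Rightarrow> 'a set set" where
  "level H s = {A \<in> H. card A = s}"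

definition star :: "'a set set \<Rightarrow> 'a set \<Rightarrow> 'a set set" where
  "star F T = {A \<in> F. T \<subseteq> A}"

text \<open>The centre of a \<open>t\<close>-star may be any \<open>t\<close>-element set; it need not lie in a member of \<open>F\<close>.\<close>

definition is_t_star :: "nat \<Rightarrow> 'a set set \<Rightarrow> 'a set set \<Rightarrow> bool" where
  "is_t_star t F G \<longleftrightarrow> (\<exists>T. finite T \<and> card T = t \<and> G = star F T)"

definition is_largest_t_star :: "nat \<Rightarrow> 'a set set \<Rightarrow> 'a set set \<Rightarrow> bool" where
  "is_largest_t_star t F G \<longleftrightarrow>
     is_t_star t F G \<and> (\<forall>G'. is_t_star t F G' \<longrightarrow> card G' \<le> card G)"

definition t_intersects :: "nat \<Rightarrow> 'a set \<Rightarrow> 'a set \<Rightarrow> bool" where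
  "t_intersects t A B \<longleftrightarrow> card (A \<inter> B) \<ge> t"

definition cross_t_intersecting :: "nat \<Rightarrow> nat \<Rightarrow> (nat \<Rightarrow> 'a set set) \<Rightarrow> bool" where
  "cross_t_intersecting t k \<A> \<longleftrightarrow>
     (\<forall>i\<in>{1..k}. \<forall>j\<in>{1..k}. i \<noteq> j \<longrightarrow> (\<forall>A\<in>\<A> i. \<forall>B\<in>\<A> j. t_intersects t A B))"

text \<open>The following are used for \<open>1 \<le> t \<le> r\<close>, so the subtractions on natural numbers are not
  truncated; the division by 2 is exact since \<open>r - t\<close> and \<open>r - t + 5\<close> have opposite parity.\<close>

definition m_bound :: "nat \<Rightarrow> nat \<Rightarrow> nat" where
  "m_bound r t = max (2 * r) ((r - t) * (r - t + 5) div 2 + (t - 1))"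

definition n_S :: "nat \<Rightarrow> nat \<Rightarrow> nat" where
  "n_S r t = (r - t + 1) * (m_bound r t choose (t + 1)) + r"

end

theory Submission
  imports Defs
begin

text \<open>If some \<open>\<A> j\<close> has no \<open>t\<close> points common to all its members, then a subfamily with that
  property has a union \<open>X\<close> of size at most \<open>m(r,t)\<close>, and every set of every other \<open>\<A> i\<close> has at least
  \<open>t + 1\<close> points in \<open>X\<close>. Stars of \<open>(t+1)\<close>-sets are so small compared with stars of \<open>t\<close>-sets that
  \<open>\<A> i\<close> has at most \<open>d/(d+1)\<close> times the size of a largest \<open>t\<close>-star of \<open>\<F> i\<close>, where \<open>d = r - t\<close>.
  If another family is nonempty, all members of \<open>\<A> j\<close> meet a fixed set of size at most \<open>r\<close>, so \<open>(d+1)|\<A> j| < |\<F> j|\<close>;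
  when the total reaches the sum of the largest stars, the other families together have size at most
  \<open>d|\<A> j|\<close>, hence the total is below \<open>|\<F> j|\<close>. If no \<open>\<A> j\<close> is of this kind, each lies in a
  \<open>t\<close>-star, and full stars with different centres are not cross-\<open>t\<close>-intersecting.\<close>

section \<open>Slices, stars and bases\<close>

text \<open>The families \<open>\<F> i\<close> as a single condition on cardinality: a set obtained
  by exchanging elements stays in the family as soon as it lies in \<open>H\<close> and keeps its
  size.\<close>

definition slice :: "'a set set \<Rightarrow> nat set \<Rightarrow> 'a set set" where
  "slice H S = {A \<in> H. card A \<in> S}"

lemma finite_slice: "finite H \<Longrightarrow> finite (slice H S)"
  by (simp add: slice_def)

lemma finite_star: "finite F \<Longrightarrow> finite (star F T)"
  by (simp add: star_def)

lemma star_empty [simp]: "star F {} = F"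
  by (simp add: star_def)

lemma subset_base:
  assumes "finite H" "A \<in> H"
  obtains B where "is_base H B" "A \<subseteq> B"
proof -
  obtain B where "B \<in> H" "A \<subseteq> B" "\<forall>C\<in>H. B \<subseteq> C \<longrightarrow> B = C"
    using finite_has_maximal2[OF assms] by blast
  then show ?thesis
    by (intro that[of B]) (auto simp: is_base_def)
qed

lemma mu_le_card_base:
  assumes "finite H" "is_base H B"
  shows "mu H \<le> card B"
proof -
  have "finite {B. is_base H B}"
    by (rule finite_subset[OF _ assms(1)]) (auto simp: is_base_def)
  then show ?thesis
    using assms(2) by (auto simp: mu_def)
qed

section \<open>Subfamilies with small union and small intersection\<close>

text \<open>If \<open>A\<close> had at most \<open>t\<close> points in the union, each
  \<open>A \<inter> B\<close> would be all of \<open>A \<inter> \<Union>G\<close>; these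
  \<open>t\<close> points would then be common to all members of \<open>G\<close>.\<close>

lemma card_Int_Union_ge:
  assumes "G \<noteq> {}" "\<And>B. B \<in> G \<Longrightarrow> finite B" "card (\<Inter>G) < t" "finite A"
    and "\<And>B. B \<in> G \<Longrightarrow> t \<le> card (A \<inter> B)"
  shows "t + 1 \<le> card (A \<inter> \<Union>G)"
proof (rule ccontr)
  assume small: "\<not> ?thesis"
  have eq: "A \<inter> B = A \<inter> \<Union>G" if "B \<in> G" for B
  proof (rule card_seteq)
    show "card (A \<inter> \<Union>G) \<le> card (A \<inter> B)"
      using assms(5)[OF that] small by simp
  qed (use that assms(4) in auto)
  obtain B where B: "B \<in> G"
    using assms(1) by blast
  have "A \<inter> B \<subseteq> \<Inter>G"
    using eq B by blast
  moreover have "finite (\<Inter>G)"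
    using B assms(2) by blast
  ultimately show False
    using card_mono[of "\<Inter>G" "A \<inter> B"] assms(5)[OF B] assms(3) by simp
qed

lemma small_union_subfamily_pairwise:
  assumes G: "G \<noteq> {}" "\<And>A. A \<in> G \<Longrightarrow> finite A \<and> card A \<le> r" "card (\<Inter>G) < t"
    and int: "\<And>A B. A \<in> G \<Longrightarrow> B \<in> G \<Longrightarrow> t \<le> card (A \<inter> B)"
  shows "\<exists>K\<subseteq>G. finite K \<and> K \<noteq> {} \<and> card (\<Inter>K) < t \<and>
           card (\<Union>K) \<le> (r - t) * (r - t + 5) div 2 + (t - 1)"
proof -
  \<comment> \<open>A set that cuts the intersection down to size \<open>v\<close> adds at most \<open>r - v\<close> points to the union,
    whence the bound \<open>r + (\<Sum>v=c..r. r - v)\<close> on the union, \<open>c\<close> being the size of the intersection. The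
    last set takes the intersection below \<open>t\<close> and adds at most \<open>r - t - 1\<close> points.\<close>
  define Q where "Q K \<longleftrightarrow> K \<subseteq> G \<and> finite K \<and> K \<noteq> {} \<and> t \<le> card (\<Inter>K) \<and>
    2 * card (\<Union>K) \<le> 2 * r + (r - card (\<Inter>K)) * (r - card (\<Inter>K) + 1)" for K
  obtain A0 where A0: "A0 \<in> G"
    using G(1) by blast
  have "Q {A0}"
    using A0 G(2)[OF A0] int[OF A0 A0] by (auto simp: Q_def)
  \<comment> \<open>Minimality replaces a greedy process: a further set that cuts the intersection
    must violate \<open>Q\<close>, and this is only possible by taking the intersection below
    \<open>t\<close>.\<close>
  then obtain K where K: "Q K" "\<And>L. Q L \<Longrightarrow> card (\<Inter>K) \<le> card (\<Inter>L)"
    using ex_has_least_nat[of Q "{A0}" "\<lambda>K. card (\<Inter>K)"] by blast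
  have KG: "K \<subseteq> G" and finK: "finite K" and K0: "K \<noteq> {}" and tK: "t \<le> card (\<Inter>K)"
    and PK: "2 * card (\<Union>K) \<le> 2 * r + (r - card (\<Inter>K)) * (r - card (\<Inter>K) + 1)"
    using K(1) by (auto simp: Q_def)
  obtain K1 where K1: "K1 \<in> K"
    using K0 by blast
  have finI: "finite (\<Inter>K)"
    using K1 KG G(2) by blast
  have finU: "finite (\<Union>K)"
    using finK KG G(2) by auto
  have Ir: "card (\<Inter>K) \<le> r"
    using K1 KG G(2) by (meson Inter_lower card_mono in_mono le_trans)
  have finG: "finite (\<Inter>G)"
    using A0 G(2) by blast
  have "\<not> \<Inter>K \<subseteq> \<Inter>G"
    using card_mono[OF finG] tK G(3) by (meson le_trans not_less)
  then obtain B where B: "B \<in> G" "\<not> \<Inter>K \<subseteq> B"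
    by blast
  have finB: "finite B" and Br: "card B \<le> r"
    using G(2)[OF B(1)] by auto
  let ?L = "insert B K"
  have IL: "\<Inter>?L = B \<inter> \<Inter>K" and UL: "\<Union>?L = B \<union> \<Union>K"
    by auto
  have lt: "card (\<Inter>?L) < card (\<Inter>K)"
    unfolding IL by (rule psubset_card_mono[OF finI]) (use B(2) in blast)
  have cU: "card (\<Union>?L) + card (B \<inter> \<Union>K) = card B + card (\<Union>K)"
    unfolding UL using card_Un_Int[OF finB finU] by simp
  have small: "card (\<Inter>?L) < t"
  proof (rule ccontr)
    assume ge: "\<not> ?thesis"
    let ?a = "r - card (\<Inter>K)" and ?b = "r - card (\<Inter>?L)"
    have "card (\<Inter>?L) \<le> card (B \<inter> \<Union>K)"
      unfolding IL by (rule card_mono) (use finB K1 in auto)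
    then have "card (\<Union>?L) \<le> card (\<Union>K) + ?b"
      using cU Br by linarith
    \<comment> \<open>The quadratic term grows by at least \<open>2 * ?b\<close>, with equality for
      \<open>?b = ?a + 1\<close>; this pays for the at most \<open>?b\<close> new points of
      \<open>B\<close>.\<close>
    moreover have "?a * (?a + 1) + 2 * ?b \<le> ?b * (?b + 1)"
    proof -
      have "?a + 1 \<le> ?b"
        using lt Ir by linarith
      then obtain c where "?b = ?a + 1 + c"
        using le_Suc_ex by blast
      then show ?thesis
        by (simp add: algebra_simps)
    qed
    ultimately have "Q ?L"
      using KG B(1) finK ge PK unfolding Q_def by auto
    then show False
      using K(2) lt by fastforce
  qed
  \<comment> \<open>Otherwise \<open>B\<close> meets all members of \<open>K\<close> in the same
    \<open>t\<close> points, and these lie in the intersection of \<open>?L\<close>. The extra point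
    improves \<open>r - t\<close> new points to \<open>r - t - 1\<close>.\<close>
  have "t + 1 \<le> card (B \<inter> \<Union>K)"
  proof (rule ccontr)
    assume neg: "\<not> ?thesis"
    have "B \<inter> A = B \<inter> \<Union>K" if "A \<in> K" for A
    proof (rule card_seteq)
      show "card (B \<inter> \<Union>K) \<le> card (B \<inter> A)"
        using int[of B A] neg B(1) that KG by force
    qed (use that finB in auto)
    then have "B \<inter> K1 \<subseteq> B \<inter> \<Inter>K"
      using K1 by blast
    then have "card (B \<inter> K1) \<le> card (\<Inter>?L)"
      unfolding IL using finI by (simp add: card_mono)
    then show False
      using int[of B K1] B(1) K1 KG small by fastforce
  qed
  then have U: "card (\<Union>?L) + t + 1 \<le> r + card (\<Union>K)" and tr: "t + 1 \<le> r"
    using cU Br card_mono[OF finB, of "B \<inter> \<Union>K"] by auto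
  \<comment> \<open>The bound carried by \<open>K\<close> is weakest when its intersection has
    exactly \<open>t\<close> points.\<close>
  have "(r - card (\<Inter>K)) * (r - card (\<Inter>K) + 1) \<le> (r - t) * (r - t + 1)"
    using tK by (intro mult_mono) auto
  then have "2 * card (\<Union>?L) + 2 * t + 2 \<le> 4 * r + (r - t) * (r - t + 1)"
    using U PK by linarith
  moreover have "4 * r = 4 * (r - t) + 4 * t"
    using tr by simp
  moreover have "(r - t) * (r - t + 5) = (r - t) * (r - t + 1) + 4 * (r - t)"
    by (simp add: algebra_simps)
  ultimately have "2 * card (\<Union>?L) \<le> (r - t) * (r - t + 5) + 2 * t - 2"
    by linarith
  moreover have "t \<ge> 1"
    using small by simp
  ultimately have "card (\<Union>?L) \<le> (r - t) * (r - t + 5) div 2 + (t - 1)"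
    by linarith
  then show ?thesis
    using KG B(1) finK small by (intro exI[of _ ?L]) auto
qed

text \<open>The two terms of the maximum in \<open>m_bound\<close> are two cases: either
  \<open>G\<close> is pairwise \<open>t\<close>-intersecting, or two members meeting in fewer than
  \<open>t\<close> points already form \<open>K\<close>, with union of size at most
  \<open>2 * r\<close>.\<close>

lemma small_union_subfamily:
  assumes G: "G \<noteq> {}" "\<And>A. A \<in> G \<Longrightarrow> finite A \<and> card A \<le> r" "card (\<Inter>G) < t"
  obtains K where "K \<subseteq> G" "finite K" "K \<noteq> {}" "card (\<Inter>K) < t" "card (\<Union>K) \<le> m_bound r t"
proof (cases "\<forall>A\<in>G. \<forall>B\<in>G. t \<le> card (A \<inter> B)")
  case True
  then obtain K where "K \<subseteq> G" "finite K" "K \<noteq> {}" "card (\<Inter>K) < t"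
    and "card (\<Union>K) \<le> (r - t) * (r - t + 5) div 2 + (t - 1)"
    using small_union_subfamily_pairwise[OF G] by blast
  then show ?thesis
    using that by (simp add: m_bound_def le_max_iff_disj)
next
  case False
  then obtain A B where AB: "A \<in> G" "B \<in> G" "card (A \<inter> B) < t"
    by force
  have "card (A \<union> B) \<le> 2 * r"
    using card_Un_le[of A B] G(2)[OF AB(1)] G(2)[OF AB(2)] by linarith
  then show ?thesis
    using AB by (intro that[of "{A, B}"]) (auto simp: m_bound_def)
qed

section \<open>Covering by stars, and binomial estimates\<close>

text \<open>Every member of \<open>\<A>\<close> contains a \<open>p\<close>-subset of
  \<open>X\<close>, so the stars of these subsets cover \<open>\<A>\<close>. The factor
  \<open>N\<close> lets bounds on stars be ratios without any division.\<close>

lemma card_le_sum_stars: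
  assumes "finite X" "finite F" "\<A> \<subseteq> F" "\<And>A. A \<in> \<A> \<Longrightarrow> p \<le> card (A \<inter> X)"
    and "\<And>T. T \<subseteq> X \<Longrightarrow> card T = p \<Longrightarrow> N * card (star F T) \<le> z"
  shows "N * card \<A> \<le> (card X choose p) * z"
proof -
  let ?P = "{T. T \<subseteq> X \<and> card T = p}"
  have finP: "finite ?P"
    using assms(1) by simp
  have "\<A> \<subseteq> (\<Union>T\<in>?P. star F T)"
  proof
    fix A
    assume A: "A \<in> \<A>"
    obtain T where "T \<subseteq> A \<inter> X" "card T = p"
      using obtain_subset_with_card_n[OF assms(4)[OF A]] by blast
    then show "A \<in> (\<Union>T\<in>?P. star F T)"
      using A assms(3) by (auto simp: star_def)
  qed
  then have "card \<A> \<le> card (\<Union>T\<in>?P. star F T)"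
    using finP assms(2) by (intro card_mono) (auto simp: finite_star)
  also have "\<dots> \<le> (\<Sum>T\<in>?P. card (star F T))"
    by (rule card_UN_le[OF finP])
  finally have "N * card \<A> \<le> (\<Sum>T\<in>?P. N * card (star F T))"
    by (simp add: sum_distrib_left[symmetric])
  also have "\<dots> \<le> of_nat (card ?P) * z"
    by (rule sum_bounded_above) (use assms(5) in blast)
  also have "card ?P = card X choose p"
    by (rule n_subsets[OF assms(1)])
  finally show ?thesis
    by simp
qed

lemma choose_ge_self:
  assumes "0 < k" "k < n"
  shows "n \<le> n choose k"
proof (cases "2 * k \<le> n")
  case True
  then show ?thesis
    using binomial_mono[of 1 k n] assms by simp
next
  case False
  then show ?thesis
    using binomial_mono[of 1 "n - k" n] assms binomial_symmetric[of k n] by simp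
qed

lemma m_bound_choose_ge: "(2 * r) choose (t + 1) \<le> m_bound r t choose (t + 1)"
  by (intro binomial_right_mono) (simp add: m_bound_def)

text \<open>This leaves room to choose a set of size at most \<open>r\<close> that avoids prescribed
  points of another such set.\<close>

lemma n_S_ge:
  assumes "1 \<le> t" "t \<le> r"
  shows "2 * r \<le> n_S r t"
proof -
  have "r \<le> (2 * r) choose (t + 1)"
  \<comment> \<open>For \<open>r = 1\<close> the lower index \<open>t + 1\<close> equals
    \<open>2 * r\<close> and the binomial coefficient is only 1; for larger \<open>r\<close> it is
    strictly below \<open>2 * r\<close>.\<close>
  proof (cases "r = 1")
    case True
    then show ?thesis
      using assms by (simp add: numeral_2_eq_2)
  next
    case False
    then show ?thesis
      using choose_ge_self[of "t + 1" "2 * r"] assms by linarith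
  qed
  also have "\<dots> \<le> (r - t + 1) * (m_bound r t choose (t + 1))"
    using mult_le_mono[OF _ m_bound_choose_ge[of r t], of 1 "r - t + 1"] by simp
  finally show ?thesis
    by (simp add: n_S_def)
qed

section \<open>Hereditary families with large bases\<close>

text \<open>The bound on the smallest base is a parameter because the lemmas use different amounts
  of it: \<open>r \<le> n\<close>, \<open>2 * r \<le> n\<close> or
  \<open>n_S r t \<le> n\<close>.\<close>

locale large_hereditary =
  fixes H :: "'a set set" and n :: nat
  assumes finite_H: "finite H"
    and finite_member: "A \<in> H \<Longrightarrow> finite A"
    and nonempty: "H \<noteq> {}"
    and hereditary: "hereditary H"
    and mu_ge: "n \<le> mu H"
begin

lemma subset_member: "A \<in> H \<Longrightarrow> B \<subseteq> A \<Longrightarrow> B \<in> H"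
  using hereditary by (auto simp: hereditary_def)

lemma large_superset:
  assumes "A \<in> H"
  obtains B where "B \<in> H" "A \<subseteq> B" "n \<le> card B"
proof -
  obtain B where B: "is_base H B" "A \<subseteq> B"
    using subset_base[OF finite_H assms] .
  then show ?thesis
    using mu_le_card_base[OF finite_H B(1)] mu_ge that[of B] by (auto simp: is_base_def)
qed

text \<open>A base above \<open>U\<close> has at least \<open>s + card Y\<close> elements, so at
  least \<open>s - card U\<close> of them lie outside \<open>U \<union> Y\<close>.\<close>

lemma extend:
  assumes "U \<in> H" "card U \<le> s" "finite Y" "s + card Y \<le> n"
  obtains A where "A \<in> H" "card A = s" "U \<subseteq> A" "A \<inter> Y \<subseteq> U"
proof -
  obtain B where B: "B \<in> H" "U \<subseteq> B" "n \<le> card B"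
    using large_superset[OF assms(1)] .
  have finU: "finite U"
    by (rule finite_member[OF assms(1)])
  have "card B - card (U \<union> Y) \<le> card (B - (U \<union> Y))"
    using finU assms(3) by (intro diff_card_le_card_Diff) simp
  then have "s - card U \<le> card (B - (U \<union> Y))"
    using card_Un_le[of U Y] assms(2,4) B(3) by linarith
  then obtain Z where Z: "Z \<subseteq> B - (U \<union> Y)" "card Z = s - card U" "finite Z"
    by (rule obtain_subset_with_card_n)
  show ?thesis
  proof (rule that[of "U \<union> Z"])
    show "U \<union> Z \<in> H"
      by (rule subset_member[OF B(1)]) (use B(2) Z(1) in blast)
    have "card (U \<union> Z) = card U + card Z"
      using finU Z by (intro card_Un_disjoint) auto
    then show "card (U \<union> Z) = s"
      using Z(2) assms(2) by simp
  qed (use Z in auto)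
qed

lemma slice_star_ne:
  assumes "U \<in> H" "s \<in> S" "card U \<le> s" "s \<le> n"
  shows "star (slice H S) U \<noteq> {}"
proof -
  obtain A where "A \<in> H" "card A = s" "U \<subseteq> A"
    using extend[of U s "{}"] assms by auto
  then have "A \<in> star (slice H S) U"
    using assms(2) by (simp add: star_def slice_def)
  then show ?thesis
    by blast
qed

text \<open>Replacing \<open>x\<close> by a new element \<open>y\<close> of a base containing \<open>A - {x}\<close> maps pairs \<open>(A, y)\<close>
  injectively to pairs consisting of a member of the larger star and a marked element outside \<open>T\<close>.\<close>

lemma card_star_insert:
  assumes "S \<subseteq> {..r}" "r \<le> n" "finite T" "x \<notin> T"
  shows "(n - r + 1) * card (star (slice H S) (insert x T))
           \<le> (r - card T) * card (star (slice H S) T)"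
proof -
  let ?F = "slice H S"
  have "\<exists>B. B \<in> H \<and> A - {x} \<subseteq> B \<and> n \<le> card B" if "A \<in> star ?F (insert x T)" for A
  proof -
    have "A - {x} \<in> H"
      using that subset_member[of A "A - {x}"] by (auto simp: star_def slice_def)
    then show ?thesis
      using large_superset by metis
  qed
  then obtain b where b: "\<And>A. A \<in> star ?F (insert x T) \<Longrightarrow>
      b A \<in> H \<and> A - {x} \<subseteq> b A \<and> n \<le> card (b A)"
    by metis
  let ?L = "Sigma (star ?F (insert x T)) (\<lambda>A. b A - (A - {x}))"
  let ?R = "Sigma (star ?F T) (\<lambda>B. B - T)"
  have fin: "finite (star ?F T)" "finite (star ?F (insert x T))"
    by (simp_all add: finite_star finite_slice finite_H)
  have finF: "finite A" "card A \<le> r" "A \<in> H" if "A \<in> ?F" for A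
    using that assms(1) finite_member by (auto simp: slice_def)
  \<comment> \<open>Each \<open>A\<close> has at least \<open>n - r + 1\<close> choices of
    \<open>y\<close>, since \<open>A - {x}\<close> has at most \<open>r - 1\<close> elements. The
    choice \<open>y = x\<close> is allowed.\<close>
  have "(n - r + 1) * card (star ?F (insert x T)) \<le>
      (\<Sum>A\<in>star ?F (insert x T). card (b A - (A - {x})))"
  proof -
    have "n - r + 1 \<le> card (b A - (A - {x}))" if A: "A \<in> star ?F (insert x T)" for A
    proof -
      have AF: "A \<in> ?F" "x \<in> A"
        using A by (auto simp: star_def)
      have "card (b A) - card (A - {x}) \<le> card (b A - (A - {x}))"
        by (rule diff_card_le_card_Diff) (simp add: finF AF)
      moreover have "card (A - {x}) = card A - 1" "card A \<ge> 1"
        using AF finF[of A] by (auto simp: card_gt_0_iff Suc_le_eq)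
      ultimately show ?thesis
        using b[OF A] finF(2)[OF AF(1)] assms(2) by linarith
    qed
    then show ?thesis
      using sum_bounded_below[of "star ?F (insert x T)" "n - r + 1"] by (simp add: mult.commute)
  qed
  also have "\<dots> = card ?L"
    using fin(2) b finite_member by (intro card_SigmaI[symmetric]) auto
  also have "\<dots> \<le> card ?R"
  proof (rule card_inj_on_le)
    \<comment> \<open>The second coordinate is \<open>y\<close>; as
      \<open>y \<notin> A - {x}\<close>, deleting it from the first coordinate gives back
      \<open>A - {x}\<close>, and \<open>x \<in> A\<close>.\<close>
    show "inj_on (\<lambda>(A, y). (insert y (A - {x}), y)) ?L"
    proof (rule inj_onI, clarsimp)
      fix A A' y
      assume A: "A \<in> star ?F (insert x T)" "A' \<in> star ?F (insert x T)"
        and y: "y \<in> A \<longrightarrow> y = x" "y \<in> A' \<longrightarrow> y = x"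
        and eq: "insert y (A - {x}) = insert y (A' - {x})"
      have "A - {x} = A' - {x}"
        using eq y insert_ident[of y "A - {x}" "A' - {x}"] by blast
      moreover have "x \<in> A" "x \<in> A'"
        using A by (auto simp: star_def)
      ultimately show "A = A'"
        by blast
    qed
    show "(\<lambda>(A, y). (insert y (A - {x}), y)) ` ?L \<subseteq> ?R"
    proof (rule image_subsetI)
      fix p
      assume "p \<in> ?L"
      then obtain A y where p: "p = (A, y)" and A: "A \<in> star ?F (insert x T)"
        and y: "y \<in> b A" "y \<notin> A - {x}"
        by blast
      have AF: "A \<in> ?F" "insert x T \<subseteq> A"
        using A by (auto simp: star_def)
      have "insert y (A - {x}) \<in> H"
        using b[OF A] y(1) subset_member[of "b A"] by blast
      moreover have "card (insert y (A - {x})) = card A"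
        using card_Suc_Diff1[of A x] AF finF(1)[of A] y(2) by simp
      ultimately have "insert y (A - {x}) \<in> ?F"
        using AF(1) by (simp add: slice_def)
      moreover have "T \<subseteq> insert y (A - {x})" "y \<notin> T"
        using AF(2) assms(4) y(2) by auto
      ultimately show "(case p of (A, y) \<Rightarrow> (insert y (A - {x}), y)) \<in> ?R"
        by (simp add: p star_def)
    qed
    show "finite ?R"
      by (intro finite_SigmaI finite_Diff fin(1)) (simp add: star_def finF(1))
  qed
  also have "\<dots> = (\<Sum>B\<in>star ?F T. card (B - T))"
    by (intro card_SigmaI ballI finite_Diff fin(1)) (simp add: star_def finF(1))
  also have "\<dots> \<le> of_nat (card (star ?F T)) * (r - card T)"
  proof (rule sum_bounded_above)
    fix B
    assume "B \<in> star ?F T"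
    then show "card (B - T) \<le> r - card T"
      using finF(2)[of B] assms(3) by (auto simp: star_def card_Diff_subset)
  qed
  finally show ?thesis
    by (simp add: mult.commute)
qed

section \<open>Bounds for cross-intersecting families\<close>

text \<open>Each member of \<open>\<A>\<close> has \<open>t + 1\<close> points in the union of a
  small subfamily \<open>K\<close> of \<open>G\<close>, so at most \<open>?C\<close> stars of
  \<open>(t+1)\<close>-sets cover \<open>\<A>\<close>. Each has at most
  \<open>(r - t) / (n - r + 1)\<close> times \<open>M\<close> members, and \<open>n_S\<close> is
  such that \<open>n - r\<close> is at least \<open>(r - t + 1) * ?C\<close>; hence
  \<open>?C\<close> cancels.\<close>

lemma card_cross_nontrivial:
  assumes "1 \<le> t" "t \<le> r" "n_S r t \<le> n" "S \<subseteq> {..r}"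
    and G: "G \<noteq> {}" "\<And>B. B \<in> G \<Longrightarrow> finite B \<and> card B \<le> r" "card (\<Inter>G) < t"
    and sub: "\<A> \<subseteq> slice H S"
    and cross: "\<And>A B. A \<in> \<A> \<Longrightarrow> B \<in> G \<Longrightarrow> t \<le> card (A \<inter> B)"
    and M: "\<And>U. card U = t \<Longrightarrow> card (star (slice H S) U) \<le> M"
  shows "(r - t + 1) * card \<A> \<le> (r - t) * M"
proof -
  let ?C = "m_bound r t choose (t + 1)"
  obtain K where K: "K \<subseteq> G" "finite K" "K \<noteq> {}" "card (\<Inter>K) < t" "card (\<Union>K) \<le> m_bound r t"
    using small_union_subfamily[OF G] .
  have rn: "r \<le> n"
    using assms(3) by (simp add: n_S_def)
  have finU: "finite (\<Union>K)"
    using K(1,2) G(2) by (intro finite_Union) auto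
  have meet: "t + 1 \<le> card (A \<inter> \<Union>K)" if "A \<in> \<A>" for A
  proof (rule card_Int_Union_ge[OF K(3) _ K(4)])
    show "finite A"
      using that sub finite_member by (auto simp: slice_def)
  qed (use K(1) G(2) cross that in auto)
  have small: "(n - r + 1) * card (star (slice H S) T) \<le> (r - t) * M" if T: "card T = t + 1" for T
  proof -
    obtain x T0 where x: "T = insert x T0" "x \<notin> T0" "card T0 = t" "finite T0"
      using T by (metis Suc_eq_plus1 card_Suc_eq_finite)
    have "(n - r + 1) * card (star (slice H S) T) \<le> (r - t) * card (star (slice H S) T0)"
      using card_star_insert[OF assms(4) rn x(4,2)] x(1,3) by simp
    also have "\<dots> \<le> (r - t) * M"
      using M[OF x(3)] by simp
    finally show ?thesis .
  qed
  have "(n - r + 1) * card \<A> \<le> (card (\<Union>K) choose (t + 1)) * ((r - t) * M)"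
    by (rule card_le_sum_stars[OF finU finite_slice[OF finite_H] sub meet small])
  also have "\<dots> \<le> ?C * ((r - t) * M)"
    by (intro mult_right_mono binomial_right_mono K(5)) simp
  finally have upper: "(n - r + 1) * card \<A> \<le> ?C * ((r - t) * M)" .
  have "(r - t + 1) * ?C \<le> n - r + 1"
    using assms(3) by (simp add: n_S_def)
  then have "((r - t + 1) * ?C) * card \<A> \<le> (n - r + 1) * card \<A>"
    by (rule mult_le_mono1)
  then have "?C * ((r - t + 1) * card \<A>) \<le> ?C * ((r - t) * M)"
    using upper by (simp only: mult_ac)
  moreover have "0 < ?C"
    using assms(1,2) by (simp add: m_bound_def)
  ultimately show ?thesis
    by simp
qed

text \<open>As \<open>t \<ge> 1\<close>, the stars of the at most \<open>r\<close> points of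
  \<open>B\<close> cover \<open>\<A>\<close>, and each is at most the fraction
  \<open>r / (n - r + 1)\<close> of the slice. It remains to compare \<open>r * r\<close> with the
  binomial coefficient in \<open>n_S\<close>.\<close>

lemma card_meeting_fixed_set:
  assumes "1 \<le> t" "t < r" "n_S r t \<le> n" "S \<subseteq> {..r}" "finite B" "card B \<le> r"
    and sub: "\<A> \<subseteq> slice H S" and "\<A> \<noteq> {}"
    and cross: "\<And>A. A \<in> \<A> \<Longrightarrow> t \<le> card (A \<inter> B)"
  shows "(r - t + 1) * card \<A> < card (slice H S)"
proof -
  let ?F = "slice H S"
  have rn: "r \<le> n"
    using assms(3) by (simp add: n_S_def)
  have "(n - r + 1) * card \<A> \<le> (card B choose 1) * (r * card ?F)"
  proof (rule card_le_sum_stars[OF assms(5) finite_slice[OF finite_H] sub])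
    show "1 \<le> card (A \<inter> B)" if "A \<in> \<A>" for A
      using cross[OF that] assms(1) by simp
    show "(n - r + 1) * card (star ?F T) \<le> r * card ?F" if T: "card T = 1" for T
    proof -
      obtain x where "T = {x}"
        using T by (rule card_1_singletonE)
      then show ?thesis
        using card_star_insert[OF assms(4) rn, of "{}" x] by simp
    qed
  qed
  also have "\<dots> \<le> r * (r * card ?F)"
    using assms(6) by simp
  finally have upper: "(n - r + 1) * card \<A> \<le> r * r * card ?F"
    by (simp add: mult.assoc)
  have "r * r \<le> (2 * r) choose 2"
    using assms(1,2) by (simp add: choose_two)
  \<comment> \<open>Since \<open>t < r\<close>, the index \<open>t + 1\<close> is in the increasing
    half of row \<open>2 * r\<close>.\<close>
  also have "\<dots> \<le> (2 * r) choose (t + 1)"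
    using assms(1,2) by (intro binomial_mono) auto
  also have "\<dots> \<le> m_bound r t choose (t + 1)"
    by (rule m_bound_choose_ge)
  finally have "(r - t + 1) * (r * r) \<le> (r - t + 1) * (m_bound r t choose (t + 1))"
    by (rule mult_le_mono2)
  \<comment> \<open>The \<open>+ 1\<close> makes this strict, and \<open>\<A> \<noteq> {}\<close>
    carries the strictness through the multiplication.\<close>
  then have "(r - t + 1) * (r * r) < n - r + 1"
    using assms(3) by (simp add: n_S_def)
  moreover have "0 < card \<A>"
    using assms(8) finite_subset[OF sub finite_slice[OF finite_H]] by (simp add: card_gt_0_iff)
  ultimately have "(r - t + 1) * (r * r) * card \<A> < (n - r + 1) * card \<A>"
    by (rule mult_less_mono1)
  then have "(r - t + 1) * (r * r) * card \<A> < r * r * card ?F"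
    using upper by (rule less_le_trans)
  then have "r * r * ((r - t + 1) * card \<A>) < r * r * card ?F"
    by (simp only: mult_ac)
  then show ?thesis
    by simp
qed

text \<open>Choose \<open>A\<close> above \<open>U\<close> avoiding \<open>V - U\<close>, then
  \<open>B\<close> above \<open>V\<close> avoiding \<open>A - V\<close>. Their intersection lies in
  \<open>U \<inter> V\<close>, which is a proper subset of \<open>U\<close>.\<close>

lemma stars_not_cross:
  assumes U: "U \<in> H" "card U = t" and V: "V \<in> H" "card V = t" and "U \<noteq> V"
    and s: "s \<in> S" "t \<le> s" "s \<le> r" and s': "s' \<in> S'" "t \<le> s'" "s' \<le> r" and "2 * r \<le> n"
  shows "\<exists>A\<in>star (slice H S) U. \<exists>B\<in>star (slice H S') V. card (A \<inter> B) < t"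
proof -
  have fin: "finite U" "finite V"
    using U V finite_member by auto
  obtain A where A: "A \<in> H" "card A = s" "U \<subseteq> A" "A \<inter> V \<subseteq> U"
    using extend[of U s V] U V fin s \<open>2 * r \<le> n\<close> by auto
  obtain B where B: "B \<in> H" "card B = s'" "V \<subseteq> B" "B \<inter> A \<subseteq> V"
    using extend[of V s' A] V A s s' finite_member[OF A(1)] \<open>2 * r \<le> n\<close> by auto
  have "\<not> U \<subseteq> V"
    using card_subset_eq[OF fin(2)] U V \<open>U \<noteq> V\<close> by metis
  then have "A \<inter> B \<subset> U"
    using A B by blast
  then have "card (A \<inter> B) < t"
    using psubset_card_mono[OF fin(1)] U(2) by blast
  then show ?thesis
    using A B s(1) s'(1) by (auto simp: star_def slice_def)
qed

text \<open>A \<open>t\<close>-set with nonempty star lies in a member of \<open>H\<close>, hence in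
  \<open>level H t\<close>; so a maximum over this finite level is a maximum over all
  \<open>t\<close>-sets.\<close>

lemma largest_t_star_exists:
  assumes "1 \<le> t" "t \<le> n"
  shows "\<exists>T\<in>level H t. is_largest_t_star t (slice H S) (star (slice H S) T)"
proof -
  let ?F = "slice H S"
  let ?c = "\<lambda>T. card (star ?F T)"
  obtain A where "A \<in> H"
    using nonempty by blast
  then have "{} \<in> H"
    by (rule subset_member) simp
  then obtain T0 where "T0 \<in> H" "card T0 = t"
    using extend[of "{}" t "{}"] assms(2) by auto
  then have ne: "level H t \<noteq> {}"
    by (auto simp: level_def)
  have fin: "finite (level H t)"
    using finite_H by (simp add: level_def)
  have "Max (?c ` level H t) \<in> ?c ` level H t"
    using fin ne by (intro Max_in) auto
  then obtain T where T: "T \<in> level H t" "?c T = Max (?c ` level H t)"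
    by auto
  have "?c U \<le> ?c T" if U: "card U = t" for U
  proof (cases "star ?F U = {}")
    case False
    then have "U \<in> level H t"
      using U subset_member by (auto simp: star_def slice_def level_def)
    then show ?thesis
      unfolding T(2) using fin by (intro Max_ge) auto
  qed simp
  moreover have "finite T" "card T = t"
    using T(1) finite_member by (auto simp: level_def)
  ultimately show ?thesis
    using T(1) by (intro bexI[of _ T]) (auto simp: is_largest_t_star_def is_t_star_def)
qed

text \<open>The strict inequality shows that the case of a family \<open>\<A> j\<close> without
  \<open>t\<close> common points, next to another nonempty family, never yields equality in the
  theorem.\<close>

lemma sum_card_cross_nontrivial:
  assumes "1 \<le> t" "t \<le> r" "n_S r t \<le> n" "finite I"
    and S: "\<And>i. i \<in> I \<Longrightarrow> S i \<subseteq> {..r}"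
    and sub: "\<And>i. i \<in> I \<Longrightarrow> \<A> i \<subseteq> slice H (S i)"
    and cross: "\<And>i j A B. i \<in> I \<Longrightarrow> j \<in> I \<Longrightarrow> i \<noteq> j \<Longrightarrow> A \<in> \<A> i \<Longrightarrow> B \<in> \<A> j \<Longrightarrow> t \<le> card (A \<inter> B)"
    and M: "\<And>i U. i \<in> I \<Longrightarrow> card U = t \<Longrightarrow> card (star (slice H (S i)) U) \<le> M i"
    and j: "j \<in> I" "\<A> j \<noteq> {}" "card (\<Inter>(\<A> j)) < t"
    and b: "b \<in> I" "b \<noteq> j" "\<A> b \<noteq> {}"
  shows "(\<Sum>i\<in>I. card (\<A> i)) < max (\<Sum>i\<in>I. M i) (card (slice H (S j)))"
proof (rule ccontr)
  assume "\<not> ?thesis"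
  then have ge: "(\<Sum>i\<in>I. M i) \<le> (\<Sum>i\<in>I. card (\<A> i))"
    and ge': "card (slice H (S j)) \<le> (\<Sum>i\<in>I. card (\<A> i))"
    by auto
  have mem: "finite A" "card A \<le> r" if "i \<in> I" "A \<in> \<A> i" for i A
    using sub[OF that(1)] S[OF that(1)] that(2) finite_member by (auto simp: slice_def)
  have small: "(r - t + 1) * card (\<A> i) \<le> (r - t) * M i" if "i \<in> I - {j}" for i
  proof (rule card_cross_nontrivial[OF assms(1-3) S j(2) _ j(3) sub])
    show "t \<le> card (A \<inter> B)" if "A \<in> \<A> i" "B \<in> \<A> j" for A B
      using cross[of i j] that \<open>i \<in> I - {j}\<close> j(1) by blast
  qed (use that M mem[OF j(1)] in auto)
  have "card (\<A> b) \<noteq> 0"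
    using b finite_subset[OF sub[OF b(1)] finite_slice[OF finite_H]] by simp
  \<comment> \<open>For \<open>t = r\<close> the right-hand side of \<open>small\<close> is zero,
    which would make \<open>\<A> b\<close> empty.\<close>
  then have "t < r"
    using small[of b] b(1,2) assms(2) by (cases "t = r") auto
  obtain B where B: "B \<in> \<A> b"
    using b(3) by blast
  have large: "(r - t + 1) * card (\<A> j) < card (slice H (S j))"
    by (rule card_meeting_fixed_set[OF assms(1) \<open>t < r\<close> assms(3) S[OF j(1)]
          mem(1)[OF b(1) B] mem(2)[OF b(1) B] sub[OF j(1)] j(2)])
      (use cross[OF j(1) b(1)] b(2) B in auto)
  define y where "y = (\<Sum>i\<in>I - {j}. card (\<A> i))"
  have sum_A: "(\<Sum>i\<in>I. card (\<A> i)) = card (\<A> j) + y"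
    unfolding y_def by (rule sum.remove[OF assms(4) j(1)])
  have "(r - t + 1) * y \<le> (r - t) * (\<Sum>i\<in>I - {j}. M i)"
    unfolding y_def sum_distrib_left by (rule sum_mono) (rule small)
  also have "\<dots> \<le> (r - t) * (\<Sum>i\<in>I. M i)"
    using sum.remove[OF assms(4) j(1), of M] by simp
  \<comment> \<open>The negated claim bounds the sum of the \<open>M i\<close> by the total itself;
    cancelling \<open>(r - t) * y\<close> then isolates \<open>y\<close>.\<close>
  also have "\<dots> \<le> (r - t) * (card (\<A> j) + y)"
    using ge sum_A by simp
  finally have "y \<le> (r - t) * card (\<A> j)"
    by (simp add: algebra_simps)
  then have "card (\<A> j) + y \<le> (r - t + 1) * card (\<A> j)"
    by simp
  then show False
    using ge' sum_A large by linarith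
qed

end

section \<open>The bound and the cases of equality\<close>

theorem theorem2p4:
  fixes t r k :: nat
    and H :: "'a set set"
    and S :: "nat \<Rightarrow> nat set"
    and \<F> \<T> \<A> :: "nat \<Rightarrow> 'a set set"
  assumes tr: "1 \<le> t" "t \<le> r"
    and H_finite: "finite H" "\<And>A. A \<in> H \<Longrightarrow> finite A"
    and H_nonempty: "H \<noteq> {}"
    and H_hereditary: "hereditary H"
    and H_mu: "mu H \<ge> n_S r t"
    and k: "k \<ge> 2"
    and S: "\<And>i. i \<in> {1..k} \<Longrightarrow> S i \<noteq> {} \<and> S i \<subseteq> {t..r}"
    and \<F>: "\<And>i. i \<in> {1..k} \<Longrightarrow> \<F> i = (\<Union>s\<in>S i. level H s)"
    and \<T>: "\<And>i. i \<in> {1..k} \<Longrightarrow>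
               \<T> i = {T \<in> level H t. is_largest_t_star t (\<F> i) (star (\<F> i) T)}"
    and \<A>_cross: "cross_t_intersecting t k \<A>"
    and \<A>_sub: "\<And>i. i \<in> {1..k} \<Longrightarrow> \<A> i \<subseteq> \<F> i"
  shows "(\<forall>i\<in>{1..k}. \<T> i \<noteq> {}) \<and>
    (\<forall>T. (\<forall>i\<in>{1..k}. T i \<in> \<T> i) \<longrightarrow>
      (\<Sum>i=1..k. card (\<A> i))
        \<le> max (\<Sum>i=1..k. card (star (\<F> i) (T i))) (MAX i\<in>{1..k}. card (\<F> i)) \<and>
      ((\<Sum>i=1..k. card (\<A> i))
        = max (\<Sum>i=1..k. card (star (\<F> i) (T i))) (MAX i\<in>{1..k}. card (\<F> i)) \<longleftrightarrow>
        ((\<Sum>i=1..k. card (star (\<F> i) (T i))) > (MAX i\<in>{1..k}. card (\<F> i)) \<and>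
         (\<Inter>i\<in>{1..k}. \<T> i) \<noteq> {} \<and>
         (\<exists>U\<in>(\<Inter>i\<in>{1..k}. \<T> i). \<forall>i\<in>{1..k}. \<A> i = star (\<F> i) U)) \<or>
        ((\<Sum>i=1..k. card (star (\<F> i) (T i))) < (MAX i\<in>{1..k}. card (\<F> i)) \<and>
         (\<exists>j\<in>{1..k}. card (\<F> j) = (MAX i\<in>{1..k}. card (\<F> i)) \<and>
            \<A> j = \<F> j \<and> (\<forall>i\<in>{1..k} - {j}. \<A> i = {}))) \<or>
        ((\<Sum>i=1..k. card (star (\<F> i) (T i))) = (MAX i\<in>{1..k}. card (\<F> i)) \<and>
         (((\<Inter>i\<in>{1..k}. \<T> i) \<noteq> {} \<and>
           (\<exists>U\<in>(\<Inter>i\<in>{1..k}. \<T> i). \<forall>i\<in>{1..k}. \<A> i = star (\<F> i) U)) \<or>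
          (\<exists>j\<in>{1..k}. card (\<F> j) = (MAX i\<in>{1..k}. card (\<F> i)) \<and>
             \<A> j = \<F> j \<and> (\<forall>i\<in>{1..k} - {j}. \<A> i = {}))))))"
proof -
  let ?I = "{1..k}"
  let ?N = "MAX i\<in>?I. card (\<F> i)"
  interpret large_hereditary H "n_S r t"
    using H_finite H_nonempty H_hereditary H_mu by unfold_locales
  have n: "2 * r \<le> n_S r t"
    by (rule n_S_ge[OF tr])
  have F: "\<F> i = slice H (S i)" if "i \<in> ?I" for i
    using \<F>[OF that] by (auto simp: slice_def level_def)
  have Sr: "S i \<subseteq> {..r}" if "i \<in> ?I" for i
    using S[OF that] by auto
  have finF: "finite (\<F> i)" if "i \<in> ?I" for i
    using F[OF that] finite_slice[OF H_finite(1)] by simp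
  have T_ne: "\<T> i \<noteq> {}" if "i \<in> ?I" for i
    using largest_t_star_exists[of t "S i"] tr n F[OF that] \<T>[OF that] by auto
  have cross: "t \<le> card (A \<inter> B)"
    if "i \<in> ?I" "j \<in> ?I" "i \<noteq> j" "A \<in> \<A> i" "B \<in> \<A> j" for i j A B
    using that \<A>_cross by (auto simp: cross_t_intersecting_def t_intersects_def)
  have F_le: "card (\<F> i) \<le> ?N" if "i \<in> ?I" for i
    using that by (intro Max_ge) auto

  \<comment> \<open>\<open>common\<close> and \<open>single\<close> are the structural parts of (i)
    and (ii). Neither mentions the chosen \<open>T i\<close>.\<close>
  define common where "common \<longleftrightarrow> (\<exists>U\<in>(\<Inter>i\<in>?I. \<T> i). \<forall>i\<in>?I. \<A> i = star (\<F> i) U)"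
  define single where "single \<longleftrightarrow> (\<exists>j\<in>?I. card (\<F> j) = ?N \<and> \<A> j = \<F> j \<and> (\<forall>i\<in>?I - {j}. \<A> i = {}))"

  have main: "(\<Sum>i=1..k. card (\<A> i)) \<le> max (\<Sum>i=1..k. card (star (\<F> i) (T i))) ?N \<and>
      ((\<Sum>i=1..k. card (\<A> i)) = max (\<Sum>i=1..k. card (star (\<F> i) (T i))) ?N \<longrightarrow> common \<or> single) \<and>
      (common \<longrightarrow> (\<Sum>i=1..k. card (\<A> i)) = (\<Sum>i=1..k. card (star (\<F> i) (T i)))) \<and>
      (single \<longrightarrow> (\<Sum>i=1..k. card (\<A> i)) = ?N)"
    if T: "\<forall>i\<in>?I. T i \<in> \<T> i" for T
  proof (intro conjI impI)
    let ?M = "\<lambda>i. card (star (\<F> i) (T i))"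
    have T_largest: "T i \<in> H" "card (T i) = t" "is_largest_t_star t (\<F> i) (star (\<F> i) (T i))"
      if "i \<in> ?I" for i
    proof -
      have "T i \<in> \<T> i"
        using T that by blast
      then show "T i \<in> H" "card (T i) = t" "is_largest_t_star t (\<F> i) (star (\<F> i) (T i))"
        unfolding \<T>[OF that] by (auto simp: level_def)
    qed
    have M: "card (star (\<F> i) U) \<le> ?M i" if "i \<in> ?I" "card U = t" for i U
    proof -
      have "finite U"
        using that(2) tr(1) by (metis card.infinite not_one_le_zero)
      then show ?thesis
        using T_largest(3)[OF that(1)] that(2) unfolding is_largest_t_star_def is_t_star_def by blast
    qed
    \<comment> \<open>Two largest stars have the same size, so the sum of stars does not depend on
      the choice of centres.\<close>
    have M_eq: "card (star (\<F> i) U) = ?M i" if "i \<in> ?I" "U \<in> \<T> i" for i U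
    proof (rule antisym)
      have U: "card U = t" "is_largest_t_star t (\<F> i) (star (\<F> i) U)"
        using that \<T>[OF that(1)] by (auto simp: level_def)
      show "card (star (\<F> i) U) \<le> ?M i"
        by (rule M[OF that(1) U(1)])
      have "is_t_star t (\<F> i) (star (\<F> i) (T i))"
        using T_largest(3)[OF that(1)] by (simp add: is_largest_t_star_def)
      then show "?M i \<le> card (star (\<F> i) U)"
        using U(2) by (auto simp: is_largest_t_star_def)
    qed

    show "(\<Sum>i=1..k. card (\<A> i)) = (\<Sum>i=1..k. ?M i)" if common
    proof (rule sum.cong[OF refl])
      fix i
      assume "i \<in> ?I"
      then show "card (\<A> i) = ?M i"
        using that M_eq[of i] by (auto simp: common_def)
    qed
    have sum_single: "(\<Sum>i=1..k. card (\<A> i)) = card (\<A> j)"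
      if "j \<in> ?I" "\<forall>i\<in>?I - {j}. \<A> i = {}" for j
      using sum.remove[OF finite_atLeastAtMost that(1), of "\<lambda>i. card (\<A> i)"] that(2) by simp
    show "(\<Sum>i=1..k. card (\<A> i)) = ?N" if single
      using that sum_single by (auto simp: single_def)

    have "(\<Sum>i=1..k. card (\<A> i)) \<le> max (\<Sum>i=1..k. ?M i) ?N \<and>
      ((\<Sum>i=1..k. card (\<A> i)) = max (\<Sum>i=1..k. ?M i) ?N \<longrightarrow> common \<or> single)"
    \<comment> \<open>With at most one nonempty family the total is at most some
      \<open>card (\<F> j)\<close>; in the other case at least two families are nonempty.\<close>
    proof (cases "\<exists>j\<in>?I. \<forall>i\<in>?I - {j}. \<A> i = {}")
      case True
      then obtain j where j: "j \<in> ?I" "\<forall>i\<in>?I - {j}. \<A> i = {}"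
        by blast
      have le: "card (\<A> j) \<le> card (\<F> j)"
        by (rule card_mono[OF finF[OF j(1)] \<A>_sub[OF j(1)]])
      have "single" if "card (\<A> j) = max (\<Sum>i=1..k. ?M i) ?N"
      proof -
        have "card (\<A> j) = card (\<F> j)" "card (\<F> j) = ?N"
          using that le F_le[OF j(1)] by linarith+
        then show ?thesis
          unfolding single_def using j card_subset_eq[OF finF[OF j(1)] \<A>_sub[OF j(1)]] by blast
      qed
      then show ?thesis
        using le F_le[OF j(1)] sum_single[OF j] by (auto simp: le_max_iff_disj)
    next
      case two: False
      show ?thesis
      proof (cases "\<exists>j\<in>?I. \<A> j \<noteq> {} \<and> card (\<Inter>(\<A> j)) < t")
        case True
        then obtain j where j: "j \<in> ?I" "\<A> j \<noteq> {}" "card (\<Inter>(\<A> j)) < t"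
          by blast
        obtain b where b: "b \<in> ?I" "b \<noteq> j" "\<A> b \<noteq> {}"
          using two j(1) by blast
        have "(\<Sum>i=1..k. card (\<A> i)) < max (\<Sum>i=1..k. ?M i) (card (slice H (S j)))"
        proof (rule sum_card_cross_nontrivial[OF tr le_refl finite_atLeastAtMost Sr _ cross _ j b])
          show "\<A> i \<subseteq> slice H (S i)" if "i \<in> ?I" for i
            using \<A>_sub[OF that] F[OF that] by simp
          show "card (star (slice H (S i)) U) \<le> ?M i" if "i \<in> ?I" "card U = t" for i U
            using M[OF that] F[OF that(1)] by simp
        qed
        then show ?thesis
          using F_le[OF j(1)] F[OF j(1)] by auto
      next
        case False
        \<comment> \<open>The members of a nonempty \<open>\<A> i\<close> now share \<open>t\<close>
          points. For an empty one any \<open>t\<close>-set serves, and \<open>T i\<close> is at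
          hand.\<close>
        have "\<exists>U. card U = t \<and> \<A> i \<subseteq> star (\<F> i) U" if i: "i \<in> ?I" for i
        proof (cases "\<A> i = {}")
          case True
          then show ?thesis
            using T_largest(2)[OF i] by auto
        next
          case ne: False
          then have "t \<le> card (\<Inter>(\<A> i))"
            using False i by force
          then obtain U where "U \<subseteq> \<Inter>(\<A> i)" "card U = t"
            by (rule obtain_subset_with_card_n)
          then show ?thesis
            using \<A>_sub[OF i] by (intro exI[of _ U]) (auto simp: star_def)
        qed
        then obtain U where U: "\<And>i. i \<in> ?I \<Longrightarrow> card (U i) = t"
            "\<And>i. i \<in> ?I \<Longrightarrow> \<A> i \<subseteq> star (\<F> i) (U i)"
          by metis
        have A_le: "card (\<A> i) \<le> card (star (\<F> i) (U i))" if "i \<in> ?I" for i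
          by (rule card_mono[OF finite_star[OF finF[OF that]] U(2)[OF that]])
        have A_M: "card (\<A> i) \<le> ?M i" if "i \<in> ?I" for i
          using A_le[OF that] M[OF that U(1)[OF that]] by (rule le_trans)
        have le: "(\<Sum>i=1..k. card (\<A> i)) \<le> (\<Sum>i=1..k. ?M i)"
          by (rule sum_mono) (rule A_M)
        have "common" if "(\<Sum>i=1..k. card (\<A> i)) = max (\<Sum>i=1..k. ?M i) ?N"
        proof -
          have "(\<Sum>i=1..k. card (\<A> i)) = (\<Sum>i=1..k. ?M i)"
            using that le by linarith
          \<comment> \<open>Termwise inequalities with equal sums are equalities.\<close>
          then have eq: "card (\<A> i) = ?M i" if "i \<in> ?I" for i
            using sum_mono_inv[of "\<lambda>i. card (\<A> i)" ?I ?M i] A_M that by auto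
          have star: "\<A> i = star (\<F> i) (U i)" if "i \<in> ?I" for i
            using card_seteq[OF finite_star[OF finF[OF that]] U(2)[OF that]]
              eq[OF that] M[OF that U(1)[OF that]] by simp
          \<comment> \<open>\<open>\<A> i\<close> is as large as a largest star, which is nonempty
            because \<open>r \<le> n_S r t\<close>; thus \<open>U i\<close> is a subset of some
            member of \<open>H\<close>.\<close>
          have UH: "U i \<in> H" if i: "i \<in> ?I" for i
          proof -
            obtain s where s: "s \<in> S i" "t \<le> s" "s \<le> r"
              using S[OF i] by force
            have "star (\<F> i) (T i) \<noteq> {}"
              unfolding F[OF i]
              by (rule slice_star_ne[OF T_largest(1)[OF i] s(1)]) (use T_largest(2)[OF i] s n in auto)
            then have "?M i \<noteq> 0"
              using finite_star[OF finF[OF i]] by simp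
            then have "\<A> i \<noteq> {}"
              using eq[OF i] by auto
            then obtain A where "A \<in> \<F> i" "U i \<subseteq> A"
              using star[OF i] by (auto simp: star_def)
            then show ?thesis
              using subset_member[of A] F[OF i] by (auto simp: slice_def)
          qed
          have same: "U i = U 1" if i: "i \<in> ?I" for i
          proof (rule ccontr)
            assume ne: "U i \<noteq> U 1"
            then have "i \<noteq> 1"
              by blast
            have one: "1 \<in> ?I"
              using k by simp
            obtain s where s: "s \<in> S i" "t \<le> s" "s \<le> r"
              using S[OF i] by force
            obtain s' where s': "s' \<in> S 1" "t \<le> s'" "s' \<le> r"
              using S[OF one] by force
            obtain A B where "A \<in> star (\<F> i) (U i)" "B \<in> star (\<F> 1) (U 1)" "card (A \<inter> B) < t"
              using stars_not_cross[OF UH[OF i] U(1)[OF i] UH[OF one] U(1)[OF one] ne s s' n]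
                F[OF i] F[OF one] by auto
            then show False
              using cross[OF i one \<open>i \<noteq> 1\<close>] star[OF i] star[OF one] by fastforce
          qed
          have "U 1 \<in> \<T> i" if i: "i \<in> ?I" for i
          proof -
            have "finite (U i)"
              using UH[OF i] by (rule finite_member)
            then have "is_t_star t (\<F> i) (star (\<F> i) (U i))"
              using U(1)[OF i] by (auto simp: is_t_star_def)
            moreover have "card (star (\<F> i) (U i)) = ?M i"
              using eq[OF i] star[OF i] by simp
            ultimately have "is_largest_t_star t (\<F> i) (star (\<F> i) (U i))"
              using T_largest(3)[OF i] by (simp add: is_largest_t_star_def)
            then show ?thesis
              unfolding same[OF i, symmetric] \<T>[OF i]
              using UH[OF i] U(1)[OF i] by (simp add: level_def)
          qed
          moreover have "\<A> i = star (\<F> i) (U 1)" if i: "i \<in> ?I" for i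
            using star[OF i] same[OF i] by simp
          ultimately show ?thesis
            unfolding common_def by blast
        qed
        then show ?thesis
          using le by (auto simp: le_max_iff_disj)
      qed
    qed
    then show "(\<Sum>i=1..k. card (\<A> i)) \<le> max (\<Sum>i=1..k. ?M i) ?N"
      and "(\<Sum>i=1..k. card (\<A> i)) = max (\<Sum>i=1..k. ?M i) ?N \<Longrightarrow> common \<or> single"
      by blast+
  qed
  have common_ne: "(\<Inter>i\<in>?I. \<T> i) \<noteq> {}" if common
    using that by (auto simp: common_def)
  show ?thesis
    unfolding common_def[symmetric] single_def[symmetric]
  proof (intro conjI allI impI)
    show "\<forall>i\<in>?I. \<T> i \<noteq> {}"
      using T_ne by blast
  next
    fix T
    assume "\<forall>i\<in>?I. T i \<in> \<T> i"
    note m = main[OF this]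
    show "(\<Sum>i=1..k. card (\<A> i)) \<le> max (\<Sum>i=1..k. card (star (\<F> i) (T i))) ?N"
      using m by blast
    \<comment> \<open>With the three numbers as variables only the order of \<open>M\<close> and
      \<open>N\<close> matters: if they differ, the structure belonging to the smaller one cannot
      attain the maximum.\<close>
    obtain a M N where amN: "a = (\<Sum>i=1..k. card (\<A> i))"
      "M = (\<Sum>i=1..k. card (star (\<F> i) (T i)))" "N = ?N"
      by blast
    have "a = max M N \<longrightarrow> common \<or> single" "common \<longrightarrow> a = M" "single \<longrightarrow> a = N"
      using m unfolding amN by blast+
    then have "a = max M N \<longleftrightarrow> (N < M \<and> (\<Inter>i\<in>?I. \<T> i) \<noteq> {} \<and> common) \<or> (M < N \<and> single) \<or>
        (M = N \<and> (((\<Inter>i\<in>?I. \<T> i) \<noteq> {} \<and> common) \<or> single))"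
      using common_ne by (cases M N rule: linorder_cases) auto
    then show "(\<Sum>i=1..k. card (\<A> i)) = max (\<Sum>i=1..k. card (star (\<F> i) (T i))) ?N \<longleftrightarrow>
        (?N < (\<Sum>i=1..k. card (star (\<F> i) (T i))) \<and> (\<Inter>i\<in>?I. \<T> i) \<noteq> {} \<and> common) \<or>
        ((\<Sum>i=1..k. card (star (\<F> i) (T i))) < ?N \<and> single) \<or>
        ((\<Sum>i=1..k. card (star (\<F> i) (T i))) = ?N \<and>
          (((\<Inter>i\<in>?I. \<T> i) \<noteq> {} \<and> common) \<or> single))"
      unfolding amN .
  qed
qed

end
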